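(* There are exactly two $1$-Wilf-equivalence classes for (classical) patterns of length three, namely $\{123,132\}$ and $\{321,312,213,231\}$. For every integer $r\ge2$, there are exactly three $r$-Wilf-equivalence classes for patterns of length three, namely $\{213,231\}$, $\{123,132\}$ and $\{321,312\}$.
   Context: $S_n$ is the set of permutations of $\{1,\ldots,n\}$ written as sequences $(\tau(1),\ldots,\tau(n))$. A permutation $\tau\in S_n$ contains $\sigma\in S_k$ as a pattern if there are indices $1\le i_1<\cdots<i_k\le n$ such that for all $1\le a<b\le k$, $\tau(i_a)<\tau(i_b)$ if and only if $\sigma(a)<\sigma(b)$; otherwise $\tau$ avoids $\sigma$. For $1\le r\le n$, $S_{n,r}(\sigma)$ is the set of $\tau\in S_n$ with $\tau(1)=r$ that avoid $\sigma$. For a fixed $r\in\{1,2,\ldots\}$, two patterns $\sigma,\sigma'$ are $r$-Wilf equivalent if $|S_{n,r}(\sigma)|=|S_{n,r}(\sigma')|$ for all $n\ge r$. The patterns of length three are the six elements of $S_3$. *)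

theory Defs
  imports "HOL-Combinatorics.Multiset_Permutations"
begin

text \<open>
  A permutation \<open>\<tau>\<close> of \<open>{1..n}\<close> is the list \<open>[\<tau>(1), \<dots>, \<tau>(n)]\<close>. The entries are 1-based,
  but list positions are 0-based, so \<open>\<tau>(i)\<close> is \<open>\<tau> ! (i - 1)\<close>.
\<close>

definition perms :: "nat \<Rightarrow> nat list set" where
  "perms n = permutations_of_set {1..n}"

definition contains_pattern :: "nat list \<Rightarrow> nat list \<Rightarrow> bool" where
  "contains_pattern \<tau> \<sigma> \<longleftrightarrow>
     (\<exists>i :: nat \<Rightarrow> nat.
        strict_mono_on {..<length \<sigma>} i \<and> i ` {..<length \<sigma>} \<subseteq> {..<length \<tau>} \<and>
        (\<forall>a b. a < b \<and> b < length \<sigma> \<longrightarrow> (\<tau> ! i a < \<tau> ! i b \<longleftrightarrow> \<sigma> ! a < \<sigma> ! b)))"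

abbreviation avoids_pattern :: "nat list \<Rightarrow> nat list \<Rightarrow> bool" where
  "avoids_pattern \<tau> \<sigma> \<equiv> \<not> contains_pattern \<tau> \<sigma>"

text \<open>
  The set \<open>S\<^bsub>n,r\<^esub>(\<sigma>)\<close>. It is only meaningful for \<open>1 \<le> r \<le> n\<close>; then \<open>\<tau>\<close> is nonempty and
  \<open>hd \<tau>\<close> is \<open>\<tau>(1)\<close>.
\<close>
definition avoiders :: "nat \<Rightarrow> nat \<Rightarrow> nat list \<Rightarrow> nat list set" where
  "avoiders n r \<sigma> = {\<tau> \<in> perms n. hd \<tau> = r \<and> avoids_pattern \<tau> \<sigma>}"

definition wilf_equivalent :: "nat \<Rightarrow> nat list \<Rightarrow> nat list \<Rightarrow> bool" where
  "wilf_equivalent r \<sigma> \<sigma>' \<longleftrightarrow> (\<forall>n\<ge>r. card (avoiders n r \<sigma>) = card (avoiders n r \<sigma>'))"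

definition wilf_classes :: "nat \<Rightarrow> nat \<Rightarrow> nat list set set" where
  "wilf_classes r k =
     perms k // {(\<sigma>, \<sigma>'). \<sigma> \<in> perms k \<and> \<sigma>' \<in> perms k \<and> wilf_equivalent r \<sigma> \<sigma>'}"

lemma equiv_wilf:
  "equiv (perms k) {(\<sigma>, \<sigma>'). \<sigma> \<in> perms k \<and> \<sigma>' \<in> perms k \<and> wilf_equivalent r \<sigma> \<sigma>'}"
  by (rule equivI) (auto simp: refl_on_def sym_def trans_def wilf_equivalent_def)

end

theory Submission
  imports Defs
begin

text \<open>
  Classify the avoiders starting with a given value by their second entry. For \<open>123\<close> and \<open>132\<close> this
  gives one and the same recursion, whose solution \<open>ballot (n - 1) (r - 1)\<close> is the common cardinality;
  complementation turns it into \<open>ballot (n - 1) (n - r)\<close> for \<open>321\<close> and \<open>312\<close>. In an avoider of \<open>213\<close>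
  (of \<open>231\<close>) starting with \<open>r\<close>, all entries above \<open>r\<close> precede (follow) all entries below \<open>r\<close>, and
  the two blocks are arbitrary avoiders, which gives the product
  \<open>ballot (n - r) (n - r) * ballot (r - 1) (r - 1)\<close>. The three formulas are then told apart at
  \<open>n = 2r\<close>, \<open>n = r + 1\<close> and \<open>n = r\<close> (\<open>n = 3\<close> if \<open>r = 2\<close>).
\<close>

section \<open>Avoidance of length-three patterns, one entry at a time\<close>

text \<open>Peeling off the head turns its triples into a binary condition on the tail, so
  \<open>sorted_wrt\<close> applies. An arbitrary \<open>R\<close> lets reversal and relabelling act
  on the relation.\<close>

fun avoids3 :: "('a \<Rightarrow> 'a \<Rightarrow> 'a \<Rightarrow> bool) \<Rightarrow> 'a list \<Rightarrow> bool" where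
  "avoids3 R [] \<longleftrightarrow> True"
| "avoids3 R (x # xs) \<longleftrightarrow> sorted_wrt (\<lambda>y z. \<not> R x y z) xs \<and> avoids3 R xs"

definition pat3 :: "nat \<Rightarrow> nat \<Rightarrow> nat \<Rightarrow> nat \<Rightarrow> nat \<Rightarrow> nat \<Rightarrow> bool" where
  "pat3 a b c x y z \<longleftrightarrow> (x < y \<longleftrightarrow> a < b) \<and> (x < z \<longleftrightarrow> a < c) \<and> (y < z \<longleftrightarrow> b < c)"

lemma avoids3_iff_nth:
  "avoids3 R xs \<longleftrightarrow> (\<forall>i j k. i < j \<and> j < k \<and> k < length xs \<longrightarrow> \<not> R (xs ! i) (xs ! j) (xs ! k))"
proof (induction xs)
  case (Cons x xs)
  have eq: "(\<forall>i j k. i < j \<and> j < k \<and> k < length (x # xs) \<longrightarrow> \<not> R ((x # xs) ! i) ((x # xs) ! j) ((x # xs) ! k))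
    \<longleftrightarrow> (\<forall>j k. j < k \<and> k < length xs \<longrightarrow> \<not> R x (xs ! j) (xs ! k)) \<and>
        (\<forall>i j k. i < j \<and> j < k \<and> k < length xs \<longrightarrow> \<not> R (xs ! i) (xs ! j) (xs ! k))"
    (is "?L \<longleftrightarrow> ?A \<and> ?B")
  proof
    assume L: ?L
    have ?A
    proof (intro allI impI)
      fix j k assume "j < k \<and> k < length xs"
      then show "\<not> R x (xs ! j) (xs ! k)"
        using L[rule_format, of 0 "Suc j" "Suc k"] by simp
    qed
    moreover have ?B
    proof (intro allI impI)
      fix i j k assume "i < j \<and> j < k \<and> k < length xs"
      then show "\<not> R (xs ! i) (xs ! j) (xs ! k)"
        using L[rule_format, of "Suc i" "Suc j" "Suc k"] by simp
    qed
    ultimately show "?A \<and> ?B" ..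
  next
    assume "?A \<and> ?B"
    then show ?L
      by (auto simp: nth_Cons split: nat.split)
  qed
  show ?case
    unfolding eq avoids3.simps Cons.IH sorted_wrt_iff_nth_less by blast
qed simp

lemma avoids_pattern_iff_avoids3: "avoids_pattern \<tau> [a, b, c] \<longleftrightarrow> avoids3 (pat3 a b c) \<tau>"
proof -
  have less3: "{..<length [a, b, c]} = {0, 1, 2}"
    by auto
  have all3: "(\<forall>p q. p < q \<and> q < length [a, b, c] \<longrightarrow> P p q) \<longleftrightarrow> P 0 1 \<and> P 0 2 \<and> P 1 2"
    for P :: "nat \<Rightarrow> nat \<Rightarrow> bool"
    by (auto simp: less_Suc_eq numeral_2_eq_2)
  have "contains_pattern \<tau> [a, b, c] \<longleftrightarrow>
    (\<exists>i j k. i < j \<and> j < k \<and> k < length \<tau> \<and> pat3 a b c (\<tau> ! i) (\<tau> ! j) (\<tau> ! k))"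
    (is "_ \<longleftrightarrow> ?R")
  proof
    assume "contains_pattern \<tau> [a, b, c]"
    then obtain f :: "nat \<Rightarrow> nat" where mono: "strict_mono_on {0, 1, 2} f"
      and "f ` {0, 1, 2} \<subseteq> {..<length \<tau>}" "pat3 a b c (\<tau> ! f 0) (\<tau> ! f 1) (\<tau> ! f 2)"
      unfolding contains_pattern_def less3 all3 by (auto simp: pat3_def)
    moreover have "f 0 < f 1" "f 1 < f 2"
      by (auto intro: strict_mono_onD[OF mono])
    ultimately show ?R
      by auto
  next
    assume ?R
    then obtain i j k where ijk: "i < j" "j < k" "k < length \<tau>"
      "pat3 a b c (\<tau> ! i) (\<tau> ! j) (\<tau> ! k)"
      by blast
    \<comment> \<open>The list \<open>[i, j, k]\<close>, read as a function through
      \<open>!\<close>, is the required index embedding.\<close>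
    then show "contains_pattern \<tau> [a, b, c]"
      unfolding contains_pattern_def less3 all3
      by (intro exI[of _ "(!) [i, j, k]"]) (auto simp: pat3_def strict_mono_on_def)
  qed
  then show ?thesis
    by (auto simp: avoids3_iff_nth)
qed

text \<open>The four conjuncts treat triples with 3, 0, 1 and 2 entries in \<open>xs\<close>, in
  this order.\<close>

lemma avoids3_append:
  "avoids3 R (xs @ ys) \<longleftrightarrow> avoids3 R xs \<and> avoids3 R ys \<and>
     (\<forall>x\<in>set xs. sorted_wrt (\<lambda>y z. \<not> R x y z) ys) \<and>
     (\<forall>z\<in>set ys. sorted_wrt (\<lambda>x y. \<not> R x y z) xs)"
  by (induction xs) (auto simp: sorted_wrt_append)

lemma avoids3_rev: "avoids3 R (rev xs) \<longleftrightarrow> avoids3 (\<lambda>x y z. R z y x) xs"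
  by (induction xs) (auto simp: avoids3_append sorted_wrt_rev)

lemma avoids3_map: "avoids3 R (map f xs) \<longleftrightarrow> avoids3 (\<lambda>x y z. R (f x) (f y) (f z)) xs"
  by (induction xs) (auto simp: sorted_wrt_map)

text \<open>In \<open>pat3\<close> a tie counts as a descent, so a reversed or complemented pattern
  agrees with its counterpart only on distinct arguments; distinct positions in a distinct list
  supply these.\<close>

lemma avoids3_cong:
  assumes "\<And>x y z. \<lbrakk>x \<in> set xs; y \<in> set xs; z \<in> set xs; distinct [x, y, z]\<rbrakk> \<Longrightarrow> R x y z \<longleftrightarrow> R' x y z"
    and "distinct xs"
  shows "avoids3 R xs \<longleftrightarrow> avoids3 R' xs"
proof -
  have "R (xs ! i) (xs ! j) (xs ! k) \<longleftrightarrow> R' (xs ! i) (xs ! j) (xs ! k)"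
    if "i < j" "j < k" "k < length xs" for i j k
    using that assms(2) by (intro assms(1)) (auto simp: nth_eq_iff_index_eq)
  then show ?thesis
    unfolding avoids3_iff_nth by blast
qed

section \<open>Avoiders on arbitrary finite sets of values\<close>

text \<open>Arbitrary value sets spare the relabelling to an initial segment after an entry is
  removed.\<close>

definition Av :: "(nat \<Rightarrow> nat \<Rightarrow> nat \<Rightarrow> bool) \<Rightarrow> nat set \<Rightarrow> nat list set" where
  "Av R A = {xs \<in> permutations_of_set A. avoids3 R xs}"

text \<open>Avoiders of \<open>R\<close> on \<open>insert x A\<close> starting with \<open>x\<close>, represented by their tails.\<close>

definition Av_tl :: "(nat \<Rightarrow> nat \<Rightarrow> nat \<Rightarrow> bool) \<Rightarrow> nat set \<Rightarrow> nat \<Rightarrow> nat list set" where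
  "Av_tl R A x = {xs \<in> permutations_of_set A. avoids3 R (x # xs)}"

lemma Av_tl_empty [simp]: "Av_tl R {} x = {[]}"
  by (auto simp: Av_tl_def)

lemma card_avoiders:
  assumes "r \<in> {1..n}"
  shows "card (avoiders n r [a, b, c]) = card (Av_tl (pat3 a b c) ({1..n} - {r}) r)"
proof -
  have ne: "{1..n} \<noteq> {}"
    using assms by auto
  have "avoiders n r [a, b, c] = (#) r ` Av_tl (pat3 a b c) ({1..n} - {r}) r"
    using assms unfolding avoiders_def perms_def avoids_pattern_iff_avoids3 Av_tl_def
      permutations_of_set_nonempty[OF ne] by auto
  then show ?thesis
    by (simp add: card_image)
qed

lemma Av_tl_image:
  assumes "inj_on f A"
    and "\<And>u v w. \<lbrakk>u \<in> insert x A; v \<in> insert x A; w \<in> insert x A; distinct [u, v, w]\<rbrakk>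
      \<Longrightarrow> R' (f u) (f v) (f w) \<longleftrightarrow> R u v w" and "x \<notin> A"
  shows "card (Av_tl R' (f ` A) (f x)) = card (Av_tl R A x)"
proof -
  have "avoids3 R' (map f (x # xs)) \<longleftrightarrow> avoids3 R (x # xs)" if "xs \<in> permutations_of_set A" for xs
    unfolding avoids3_map using that assms(3)
    by (intro avoids3_cong assms(2)) (auto simp: permutations_of_set_def)
  then have "Av_tl R' (f ` A) (f x) = map f ` Av_tl R A x"
    unfolding Av_tl_def permutations_of_set_image_inj[OF assms(1)] by (auto simp del: avoids3.simps)
  moreover have "inj_on (map f) (Av_tl R A x)"
    using assms(1) by (intro inj_on_mapI) (auto simp: Av_tl_def permutations_of_set_def)
  ultimately show ?thesis
    by (simp add: card_image)
qed

lemma card_Av_tl_rec: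
  assumes "finite A" "A \<noteq> {}"
  shows "card (Av_tl R A x) =
    (\<Sum>s\<in>A. card {xs \<in> permutations_of_set (A - {s}). avoids3 R (x # s # xs)})"
proof -
  have "Av_tl R A x =
      (\<Union>s\<in>A. (#) s ` {xs \<in> permutations_of_set (A - {s}). avoids3 R (x # s # xs)})"
    unfolding Av_tl_def permutations_of_set_nonempty[OF assms(2)] by blast
  also have "card \<dots> = (\<Sum>s\<in>A. card ((#) s ` {xs \<in> permutations_of_set (A - {s}). avoids3 R (x # s # xs)}))"
    using assms(1) by (intro card_UN_disjoint) auto
  finally show ?thesis
    by (simp add: card_image)
qed

section \<open>Ballot numbers (Catalan's triangle) and the recursion on the second entry\<close>

text \<open>Here \<open>n\<close> is the number of entries after the first one, and \<open>k\<close> the number of them below it.\<close>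

fun ballot :: "nat \<Rightarrow> nat \<Rightarrow> nat" where
  "ballot 0 k = 1"
| "ballot (Suc n) k = (\<Sum>j<k. ballot n j) + (if k \<le> n then ballot n k else 0)"

text \<open>Ranks in \<open>B\<close> run through \<open>0, ..., card B - 1\<close> once each:
  adding a new maximum keeps the old ranks and contributes the rank \<open>card B\<close>.\<close>

lemma sum_rank:
  fixes B :: "'a::linorder set"
  assumes "finite B"
  shows "(\<Sum>s\<in>B. g (card {b\<in>B. b < s})) = (\<Sum>j<card B. g j)"
  using assms
proof (induction rule: finite_linorder_max_induct)
  case (insert m B)
  have "(\<Sum>s\<in>insert m B. g (card {b\<in>insert m B. b < s}))
      = g (card {b\<in>insert m B. b < m}) + (\<Sum>s\<in>B. g (card {b\<in>insert m B. b < s}))"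
    using insert.hyps by (subst sum.insert) auto
  also have "{b\<in>insert m B. b < m} = B"
    using insert.hyps by auto
  also have "(\<Sum>s\<in>B. g (card {b\<in>insert m B. b < s})) = (\<Sum>s\<in>B. g (card {b\<in>B. b < s}))"
    using insert.hyps by (intro sum.cong arg_cong[where f = "\<lambda>S. g (card S)"]) auto
  moreover have "card (insert m B) = Suc (card B)"
    using insert.hyps by (intro card_insert_disjoint) auto
  ultimately show ?case
    using insert.IH by (simp add: add.commute)
qed simp

text \<open>Both \<open>123\<close> and \<open>132\<close> fit this scheme: a second entry below \<open>x\<close> makes the condition on \<open>x\<close>
  redundant, while a second entry above \<open>x\<close> is forced to be a single value \<open>m\<close>.\<close>

lemma card_Av_tl_ballot:
  assumes below: "\<And>x s xs. s < x \<Longrightarrow> avoids3 R (x # s # xs) \<longleftrightarrow> avoids3 R (s # xs)"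
    and above: "\<And>x A. \<lbrakk>finite A; x \<notin> A; \<exists>a\<in>A. x < a\<rbrakk> \<Longrightarrow>
      \<exists>m\<in>A. x < m \<and> (\<exists>y. y \<notin> A - {m} \<and> card {a\<in>A - {m}. a < y} = card {a\<in>A. a < x} \<and>
        {xs \<in> permutations_of_set (A - {m}). avoids3 R (x # m # xs)} = Av_tl R (A - {m}) y) \<and>
        (\<forall>s\<in>A. x < s \<and> s \<noteq> m \<longrightarrow>
          {xs \<in> permutations_of_set (A - {s}). avoids3 R (x # s # xs)} = {})"
    and "finite A" "x \<notin> A"
  shows "card (Av_tl R A x) = ballot (card A) (card {a\<in>A. a < x})"
  using assms(3,4)
proof (induction "card A" arbitrary: A x)
  case 0
  then show ?case by simp
next
  case (Suc n)
  define L where "L = {a\<in>A. a < x}"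
  define G where "G = {a\<in>A. x < a}"
  let ?T = "\<lambda>s. {xs \<in> permutations_of_set (A - {s}). avoids3 R (x # s # xs)}"
  have fin: "finite L" "finite G"
    using Suc.prems by (auto simp: L_def G_def)
  have A: "A = L \<union> G" "L \<inter> G = {}"
    using Suc.prems(2) by (auto simp: L_def G_def not_less le_less)
  have n: "card (A - {s}) = n" if "s \<in> A" for s
    using that Suc.hyps(2) Suc.prems(1) by (metis card_Diff_singleton diff_Suc_1)
  have "card (Av_tl R A x) = (\<Sum>s\<in>A. card (?T s))"
    using Suc.hyps(2) Suc.prems by (intro card_Av_tl_rec) auto
  also have "\<dots> = (\<Sum>s\<in>L. card (?T s)) + (\<Sum>s\<in>G. card (?T s))"
    unfolding A(1) using sum.union_disjoint[OF fin A(2)] by simp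
  \<comment> \<open>Once \<open>s\<close> takes over as head, the values below it are those of
    \<open>L\<close>, so the second parameter becomes the rank of \<open>s\<close> in
    \<open>L\<close>.\<close>
  also have "(\<Sum>s\<in>L. card (?T s)) = (\<Sum>s\<in>L. ballot n (card {b\<in>L. b < s}))"
  proof (rule sum.cong)
    fix s assume s: "s \<in> L"
    then have "?T s = Av_tl R (A - {s}) s"
      unfolding Av_tl_def by (simp add: L_def below del: avoids3.simps)
    also have "card \<dots> = ballot n (card {a\<in>A - {s}. a < s})"
      using Suc.hyps(1)[of "A - {s}" s] n[of s] s Suc.prems by (simp add: L_def)
    also have "{a\<in>A - {s}. a < s} = {b\<in>L. b < s}"
      using s by (auto simp: L_def)
    finally show "card (?T s) = ballot n (card {b\<in>L. b < s})" .
  qed simp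
  also have "\<dots> = (\<Sum>j<card L. ballot n j)"
    by (rule sum_rank[OF fin(1)])
  \<comment> \<open>Since \<open>A\<close> has \<open>n + 1\<close> elements,
    \<open>card L \<le> n\<close> says exactly that some value lies above \<open>x\<close>.\<close>
  also have "(\<Sum>s\<in>G. card (?T s)) = (if card L \<le> n then ballot n (card L) else 0)"
  proof (cases "G = {}")
    case True
    then show ?thesis
      using A Suc.hyps(2) by simp
  next
    case False
    then have "\<exists>a\<in>A. x < a"
      by (auto simp: G_def)
    \<comment> \<open>After \<open>m\<close>, the tail behaves as if it followed the single head
      \<open>y\<close>, which has as many smaller values as \<open>x\<close> had. For 132 this is
      \<open>m\<close>, for 123 it is \<open>x\<close>.\<close>
    from above[OF Suc.prems this, folded L_def] obtain m y where m: "m \<in> A" "x < m" and y: "y \<notin> A - {m}"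
      "card {a\<in>A - {m}. a < y} = card L" "?T m = Av_tl R (A - {m}) y"
      and others: "\<forall>s\<in>A. x < s \<and> s \<noteq> m \<longrightarrow> ?T s = {}"
      by (elim bexE exE conjE) (rule that; assumption)
    have "card L \<le> card (A - {m})"
      using m Suc.prems by (intro card_mono) (auto simp: L_def)
    then have "card L \<le> n"
      using n[OF m(1)] by simp
    moreover have "(\<Sum>s\<in>G. card (?T s)) = (\<Sum>s\<in>{m}. card (?T s))"
    proof (rule sum.mono_neutral_right)
      show "\<forall>s\<in>G - {m}. card (?T s) = 0"
        using others unfolding G_def by (metis (no_types, lifting) Diff_iff card.empty mem_Collect_eq singletonI)
    qed (use m fin in \<open>auto simp: G_def\<close>)
    moreover have "\<dots> = ballot n (card L)"
      using Suc.hyps(1)[of "A - {m}" y] n[OF m(1)] y Suc.prems by simp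
    ultimately show ?thesis
      by simp
  qed
  finally show ?case
    unfolding Suc.hyps(2)[symmetric] ballot.simps(2) L_def .
qed

section \<open>The patterns 132 and 123, and their complements 312 and 321\<close>

text \<open>A second entry above \<open>x\<close> must be the next larger value \<open>m\<close>,
  since otherwise \<open>x\<close>, that entry and \<open>m\<close> form a 132. Every later entry
  above \<open>x\<close> is then above \<open>m\<close>, so \<open>m\<close> replaces
  \<open>x\<close> as head, with the same rank.\<close>

lemma card_Av_tl_132:
  assumes "finite A" "x \<notin> A"
  shows "card (Av_tl (pat3 1 3 2) A x) = ballot (card A) (card {a\<in>A. a < x})"
proof (rule card_Av_tl_ballot)
  fix x s :: nat and xs assume "s < x"
  then show "avoids3 (pat3 1 3 2) (x # s # xs) \<longleftrightarrow> avoids3 (pat3 1 3 2) (s # xs)"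
    by (auto simp: pat3_def elim!: sorted_wrt_mono_rel[rotated])
next
  fix x :: nat and A assume A: "finite A" "x \<notin> A" "\<exists>a\<in>A. x < a"
  define m where "m = Min {a\<in>A. x < a}"
  have "{a\<in>A. x < a} \<noteq> {}"
    using A(3) by blast
  then have "m \<in> {a\<in>A. x < a}"
    unfolding m_def using A(1) by (intro Min_in) auto
  then have m: "m \<in> A" "x < m"
    by auto
  have le: "m \<le> a" if "a \<in> A" "x < a" for a
    using that A by (auto simp: m_def)
  have rank: "{a\<in>A - {m}. a < m} = {a\<in>A. a < x}"
    using m le A(2) by (force simp: not_le[symmetric])
  have m_tl: "avoids3 (pat3 1 3 2) (x # m # xs) \<longleftrightarrow> avoids3 (pat3 1 3 2) (m # xs)"
    if "xs \<in> permutations_of_set (A - {m})" for xs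
  proof -
    have gt: "m < a" if "a \<in> set xs" "x < a" for a
      using that le[of a] \<open>xs \<in> _\<close> by (auto simp: permutations_of_set_def)
    then show ?thesis
      by (auto simp: pat3_def elim!: sorted_wrt_mono_rel[rotated])
  qed
  have not_m: "\<not> avoids3 (pat3 1 3 2) (x # s # xs)"
    if "s \<in> A" "x < s" "s \<noteq> m" "xs \<in> permutations_of_set (A - {s})" for s xs
  proof -
    have "m \<in> set xs" "\<not> s < m"
      using that m le[of s] by (auto simp: permutations_of_set_def)
    then show ?thesis
      using m that by (auto simp: pat3_def)
  qed
  have "{xs \<in> permutations_of_set (A - {m}). avoids3 (pat3 1 3 2) (x # m # xs)} = Av_tl (pat3 1 3 2) (A - {m}) m"
    using m_tl unfolding Av_tl_def by (intro Collect_cong conj_cong) auto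
  moreover have "{xs \<in> permutations_of_set (A - {s}). avoids3 (pat3 1 3 2) (x # s # xs)} = {}"
    if "s \<in> A" "x < s" "s \<noteq> m" for s
    using not_m[OF that] by (intro Collect_empty_eq[THEN iffD2]) simp
  ultimately show "\<exists>m\<in>A. x < m \<and> (\<exists>y. y \<notin> A - {m} \<and> card {a\<in>A - {m}. a < y} = card {a\<in>A. a < x} \<and>
        {xs \<in> permutations_of_set (A - {m}). avoids3 (pat3 1 3 2) (x # m # xs)} = Av_tl (pat3 1 3 2) (A - {m}) y) \<and>
        (\<forall>s\<in>A. x < s \<and> s \<noteq> m \<longrightarrow>
          {xs \<in> permutations_of_set (A - {s}). avoids3 (pat3 1 3 2) (x # s # xs)} = {})"
    using m A(2) rank
    by (intro bexI[of _ m] conjI exI[of _ m] ballI impI) (simp_all only: Diff_iff insert_iff simp_thms)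
qed (fact assms)+

text \<open>A second entry above \<open>x\<close> must be the maximum \<open>m\<close>, since
  otherwise \<open>m\<close> follows it and completes a 123. Being maximal, \<open>m\<close> lies in
  no 123 as second entry and can be erased, so the head stays \<open>x\<close>.\<close>

lemma card_Av_tl_123:
  assumes "finite A" "x \<notin> A"
  shows "card (Av_tl (pat3 1 2 3) A x) = ballot (card A) (card {a\<in>A. a < x})"
proof (rule card_Av_tl_ballot)
  fix x s :: nat and xs assume "s < x"
  then show "avoids3 (pat3 1 2 3) (x # s # xs) \<longleftrightarrow> avoids3 (pat3 1 2 3) (s # xs)"
    by (auto simp: pat3_def elim!: sorted_wrt_mono_rel[rotated])
next
  fix x :: nat and A assume A: "finite A" "x \<notin> A" "\<exists>a\<in>A. x < a"
  define m where "m = Max A"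
  have le: "a \<le> m" if "a \<in> A" for a
    using that A by (auto simp: m_def)
  obtain a where "a \<in> A" "x < a"
    using A(3) by blast
  then have m: "m \<in> A" "x < m"
    using le[of a] Max_in[of A] A(1) unfolding m_def by (blast, linarith)
  have rank: "{a\<in>A - {m}. a < x} = {a\<in>A. a < x}"
    using m by auto
  have m_tl: "avoids3 (pat3 1 2 3) (x # m # xs) \<longleftrightarrow> avoids3 (pat3 1 2 3) (x # xs)"
    if "xs \<in> permutations_of_set (A - {m})" for xs
  proof -
    have "\<not> m < a" if "a \<in> set xs" for a
      using that le[of a] \<open>xs \<in> _\<close> by (auto simp: permutations_of_set_def)
    then have "sorted_wrt (\<lambda>y z. \<not> pat3 1 2 3 m y z) xs" "\<forall>z\<in>set xs. \<not> pat3 1 2 3 x m z"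
      by (auto simp: sorted_wrt_iff_nth_less pat3_def)
    then show ?thesis
      by simp
  qed
  have not_m: "\<not> avoids3 (pat3 1 2 3) (x # s # xs)"
    if "s \<in> A" "x < s" "s \<noteq> m" "xs \<in> permutations_of_set (A - {s})" for s xs
  proof -
    have "m \<in> set xs" "s < m"
      using that m le[of s] by (auto simp: permutations_of_set_def)
    moreover have "pat3 1 2 3 x s m"
      using m that \<open>s < m\<close> by (simp add: pat3_def)
    ultimately show ?thesis
      by auto
  qed
  have "{xs \<in> permutations_of_set (A - {m}). avoids3 (pat3 1 2 3) (x # m # xs)} = Av_tl (pat3 1 2 3) (A - {m}) x"
    using m_tl unfolding Av_tl_def by (intro Collect_cong conj_cong) auto
  moreover have "{xs \<in> permutations_of_set (A - {s}). avoids3 (pat3 1 2 3) (x # s # xs)} = {}"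
    if "s \<in> A" "x < s" "s \<noteq> m" for s
    using not_m[OF that] by (intro Collect_empty_eq[THEN iffD2]) simp
  ultimately show "\<exists>m\<in>A. x < m \<and> (\<exists>y. y \<notin> A - {m} \<and> card {a\<in>A - {m}. a < y} = card {a\<in>A. a < x} \<and>
        {xs \<in> permutations_of_set (A - {m}). avoids3 (pat3 1 2 3) (x # m # xs)} = Av_tl (pat3 1 2 3) (A - {m}) y) \<and>
        (\<forall>s\<in>A. x < s \<and> s \<noteq> m \<longrightarrow>
          {xs \<in> permutations_of_set (A - {s}). avoids3 (pat3 1 2 3) (x # s # xs)} = {})"
    using m A(2) rank
    by (intro bexI[of _ m] conjI exI[of _ x] ballI impI) (simp_all only: Diff_iff insert_iff simp_thms)
qed (fact assms)+

text \<open>The order-reversing map \<open>a \<mapsto> N - a\<close> exchanges values below and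
  above the head.\<close>

lemma card_Av_tl_complement:
  assumes R: "\<And>A x. \<lbrakk>finite A; x \<notin> A\<rbrakk> \<Longrightarrow> card (Av_tl R A x) = ballot (card A) (card {a\<in>A. a < x})"
    and R': "\<And>u v w N. \<lbrakk>u \<le> N; v \<le> N; w \<le> N; distinct [u, v, w]\<rbrakk> \<Longrightarrow> R (N - u) (N - v) (N - w) \<longleftrightarrow> R' u v w"
    and "finite A" "x \<notin> A"
  shows "card (Av_tl R' A x) = ballot (card A) (card {a\<in>A. x < a})"
proof -
  \<comment> \<open>A common bound makes the truncated subtraction injective and order-reversing on
    all values involved.\<close>
  obtain N where N: "\<And>a. a \<in> insert x A \<Longrightarrow> a \<le> N"
    using finite_nat_set_iff_bounded_le[of "insert x A"] assms(3) by auto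
  let ?f = "\<lambda>a. N - a"
  have inj: "inj_on ?f (insert x A)"
    using N by (intro inj_onI) (metis diff_diff_cancel)
  have "card (Av_tl R' A x) = card (Av_tl R (?f ` A) (?f x))"
    using assms(4) inj N by (intro Av_tl_image[symmetric] R') auto
  also have "\<dots> = ballot (card (?f ` A)) (card {a\<in>?f ` A. a < ?f x})"
    using assms(3,4) inj by (intro R) auto
  also have "{a\<in>?f ` A. a < ?f x} = ?f ` {a\<in>A. x < a}"
    using N by force
  also have "card \<dots> = card {a\<in>A. x < a}"
    using inj by (intro card_image inj_on_subset[OF inj]) auto
  also have "card (?f ` A) = card A"
    using inj by (intro card_image inj_on_subset[OF inj]) auto
  finally show ?thesis .
qed

lemma card_Av_tl_321:
  assumes "finite A" "x \<notin> A"
  shows "card (Av_tl (pat3 3 2 1) A x) = ballot (card A) (card {a\<in>A. x < a})"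
  by (rule card_Av_tl_complement[OF card_Av_tl_123 _ assms]) (auto simp: pat3_def)

lemma card_Av_tl_312:
  assumes "finite A" "x \<notin> A"
  shows "card (Av_tl (pat3 3 1 2) A x) = ballot (card A) (card {a\<in>A. x < a})"
  by (rule card_Av_tl_complement[OF card_Av_tl_132 _ assms]) (auto simp: pat3_def)

section \<open>The patterns 231 and 213: reversal and the product formula\<close>

lemma card_Av_rev: "card (Av (\<lambda>x y z. R z y x) A) = card (Av R A)"
proof -
  have "Av R A = rev ` Av (\<lambda>x y z. R z y x) A"
  proof (intro equalityI subsetI)
    fix xs assume "xs \<in> Av R A"
    then have "rev xs \<in> Av (\<lambda>x y z. R z y x) A"
      by (auto simp: Av_def avoids3_rev permutations_of_set_def)
    then show "xs \<in> rev ` Av (\<lambda>x y z. R z y x) A"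
      by force
  qed (auto simp: Av_def avoids3_rev permutations_of_set_def)
  then show ?thesis
    by (simp add: card_image)
qed

lemma Av_cong:
  assumes "\<And>x y z. distinct [x, y, z] \<Longrightarrow> R x y z \<longleftrightarrow> R' x y z"
  shows "Av R A = Av R' A"
  using assms unfolding Av_def
  by (intro Collect_cong conj_cong avoids3_cong) (auto simp: permutations_of_set_def)

text \<open>A head that never starts an occurrence imposes nothing, so counts of all avoiders can be
  read off counts with a prescribed head.\<close>

lemma Av_tl_eq_Av:
  assumes "\<And>y z. \<lbrakk>y \<in> A; z \<in> A\<rbrakk> \<Longrightarrow> \<not> R x y z"
  shows "Av_tl R A x = Av R A"
  using assms unfolding Av_tl_def Av_def
  by (auto simp: permutations_of_set_def sorted_wrt_iff_nth_less)

text \<open>A head above all of \<open>A\<close> cannot be the 1 of a 132; reversal then turns 132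
  into 231. The diagonal ballot numbers are the Catalan numbers.\<close>

lemma card_Av_231:
  assumes "finite A"
  shows "card (Av (pat3 2 3 1) A) = ballot (card A) (card A)"
proof -
  obtain x where x: "\<And>a. a \<in> A \<Longrightarrow> a < x"
    using finite_nat_set_iff_bounded assms by auto
  then have "card (Av_tl (pat3 1 3 2) A x) = ballot (card A) (card {a\<in>A. a < x})"
    using assms by (intro card_Av_tl_132) auto
  also have "{a\<in>A. a < x} = A"
    using x by auto
  also have "Av_tl (pat3 1 3 2) A x = Av (pat3 1 3 2) A"
    by (rule Av_tl_eq_Av) (use x in \<open>auto simp: pat3_def dest: less_asym\<close>)
  also have "card \<dots> = card (Av (\<lambda>x y z. pat3 1 3 2 z y x) A)"
    by (rule card_Av_rev[symmetric])
  also have "Av (\<lambda>x y z. pat3 1 3 2 z y x) A = Av (pat3 2 3 1) A"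
    by (rule Av_cong) (auto simp: pat3_def)
  finally show ?thesis .
qed

text \<open>The head 0 lies below all of \<open>A\<close> and cannot be the 3 of a 312; reversal
  then turns 312 into 213.\<close>

lemma card_Av_213:
  assumes "finite A" "0 \<notin> A"
  shows "card (Av (pat3 2 1 3) A) = ballot (card A) (card A)"
proof -
  have "card (Av_tl (pat3 3 1 2) A 0) = ballot (card A) (card {a\<in>A. 0 < a})"
    using assms by (rule card_Av_tl_312)
  also have "{a\<in>A. 0 < a} = A"
    using assms by (auto intro: gr0I)
  also have "Av_tl (pat3 3 1 2) A 0 = Av (pat3 3 1 2) A"
  proof (rule Av_tl_eq_Av)
    fix y z assume "y \<in> A"
    then have "0 < y"
      using assms by (metis gr0I)
    then show "\<not> pat3 3 1 2 0 y z"
      by (simp add: pat3_def)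
  qed
  also have "card \<dots> = card (Av (\<lambda>x y z. pat3 3 1 2 z y x) A)"
    by (rule card_Av_rev[symmetric])
  also have "Av (\<lambda>x y z. pat3 3 1 2 z y x) A = Av (pat3 2 1 3) A"
    by (rule Av_cong) (auto simp: pat3_def)
  finally show ?thesis .
qed

text \<open>The common length \<open>n\<close> fixes where to cut, so concatenation is
  injective.\<close>

lemma card_append_product:
  assumes "\<And>xs. xs \<in> X \<Longrightarrow> length xs = n"
  shows "card {xs @ ys |xs ys. xs \<in> X \<and> ys \<in> Y} = card X * card Y"
proof -
  have "{xs @ ys |xs ys. xs \<in> X \<and> ys \<in> Y} = (\<lambda>(xs, ys). xs @ ys) ` (X \<times> Y)"
    by auto
  moreover have "inj_on (\<lambda>(xs, ys). xs @ ys) (X \<times> Y)"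
    using assms by (auto intro!: inj_onI)
  ultimately show ?thesis
    by (simp add: card_image card_cartesian_product)
qed

lemma sorted_wrt_append_filter:
  assumes "sorted_wrt (\<lambda>y z. \<not> (\<not> P y \<and> P z)) xs"
  shows "xs = filter P xs @ filter (\<lambda>y. \<not> P y) xs"
  using assms
proof (induction xs)
  case (Cons y xs)
  then show ?case
    by (cases "P y") (auto simp: filter_empty_conv filter_id_conv)
qed simp

text \<open>By \<open>head\<close>, avoiding occurrences that start at \<open>x\<close> means that
  no entry satisfying \<open>P\<close> follows one that does not, so the tail is two blocks. By
  \<open>cross\<close>, no occurrence straddles them, so they are chosen independently.\<close>

lemma Av_tl_split:
  assumes head: "\<And>y z. \<lbrakk>y \<in> A; z \<in> A\<rbrakk> \<Longrightarrow> R x y z \<longleftrightarrow> \<not> P y \<and> P z"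
    and cross: "\<And>u v w. \<lbrakk>u \<in> A; v \<in> A; w \<in> A; P u; \<not> P w\<rbrakk> \<Longrightarrow> \<not> R u v w"
  shows "card (Av_tl R A x) = card (Av R {a\<in>A. P a}) * card (Av R {a\<in>A. \<not> P a})"
proof -
  have "Av_tl R A x = {xs @ ys |xs ys. xs \<in> Av R {a\<in>A. P a} \<and> ys \<in> Av R {a\<in>A. \<not> P a}}"
    (is "_ = ?S")
  proof (intro equalityI subsetI)
    fix zs assume zs: "zs \<in> Av_tl R A x"
    then have set: "set zs = A" "distinct zs" and av: "avoids3 R zs"
      and s: "sorted_wrt (\<lambda>y z. \<not> R x y z) zs"
      by (auto simp: Av_tl_def permutations_of_set_def)
    have "sorted_wrt (\<lambda>y z. \<not> (\<not> P y \<and> P z)) zs"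
      using s by (rule sorted_wrt_mono_rel[rotated]) (use head set in auto)
    then have eq: "zs = filter P zs @ filter (\<lambda>y. \<not> P y) zs"
      by (rule sorted_wrt_append_filter)
    then have "avoids3 R (filter P zs) \<and> avoids3 R (filter (\<lambda>y. \<not> P y) zs)"
      using av avoids3_append by metis
    then have "filter P zs \<in> Av R {a\<in>A. P a}" "filter (\<lambda>y. \<not> P y) zs \<in> Av R {a\<in>A. \<not> P a}"
      using set by (auto simp: Av_def permutations_of_set_def)
    with eq show "zs \<in> ?S"
      by blast
  next
    fix zs assume "zs \<in> ?S"
    then obtain xs ys where zs: "zs = xs @ ys"
      and xs: "set xs = {a\<in>A. P a}" "distinct xs" "avoids3 R xs"
      and ys: "set ys = {a\<in>A. \<not> P a}" "distinct ys" "avoids3 R ys"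
      by (auto simp: Av_def permutations_of_set_def)
    have sorted: "sorted_wrt Q us" if "\<And>u v. \<lbrakk>u \<in> set us; v \<in> set us\<rbrakk> \<Longrightarrow> Q u v" for Q us
      using that by (auto simp: sorted_wrt_iff_nth_less)
    \<comment> \<open>A straddling triple starts in \<open>xs\<close> and ends in \<open>ys\<close>,
      wherever its middle entry lies; \<open>cross\<close> excludes both cases.\<close>
    have "sorted_wrt (\<lambda>y z. \<not> R u y z) ys" if "u \<in> set xs" for u
      using that xs(1) ys(1) cross by (intro sorted) auto
    moreover have "sorted_wrt (\<lambda>u v. \<not> R u v w) xs" if "w \<in> set ys" for w
      using that xs(1) ys(1) cross by (intro sorted) auto
    moreover have "sorted_wrt (\<lambda>y z. \<not> R x y z) xs" "sorted_wrt (\<lambda>y z. \<not> R x y z) ys"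
      using xs(1) ys(1) head by (intro sorted; simp)+
    moreover have "\<not> R x y z" if "y \<in> set xs" "z \<in> set ys" for y z
      using that xs ys head by auto
    ultimately show "zs \<in> Av_tl R A x"
      using xs ys by (auto simp: zs Av_tl_def permutations_of_set_def avoids3_append sorted_wrt_append)
  qed
  moreover have "length xs = card {a\<in>A. P a}" if "xs \<in> Av R {a\<in>A. P a}" for xs
    using that by (auto simp: Av_def permutations_of_set_def distinct_card[symmetric])
  ultimately show ?thesis
    by (simp add: card_append_product)
qed

text \<open>Here the block above \<open>x\<close> comes first. The last letter of 213 exceeds the
  first, so no occurrence runs from the upper block into the lower one.\<close>

lemma card_Av_tl_213:
  assumes "finite A" "x \<notin> A" "0 \<notin> A"
  shows "card (Av_tl (pat3 2 1 3) A x) =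
    ballot (card {a\<in>A. x < a}) (card {a\<in>A. x < a}) * ballot (card {a\<in>A. a < x}) (card {a\<in>A. a < x})"
proof -
  have "card (Av_tl (pat3 2 1 3) A x) =
      card (Av (pat3 2 1 3) {a\<in>A. x < a}) * card (Av (pat3 2 1 3) {a\<in>A. \<not> x < a})"
    using assms by (intro Av_tl_split) (auto simp: pat3_def)
  also have "{a\<in>A. \<not> x < a} = {a\<in>A. a < x}"
    using assms by (auto simp: not_less le_less)
  finally show ?thesis
    using assms card_Av_213[of "{a\<in>A. x < a}"] card_Av_213[of "{a\<in>A. a < x}"] by simp
qed

text \<open>Now the lower block comes first, and no 231 can start in it and end in the upper
  one.\<close>

lemma card_Av_tl_231:
  assumes "finite A" "x \<notin> A"
  shows "card (Av_tl (pat3 2 3 1) A x) =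
    ballot (card {a\<in>A. x < a}) (card {a\<in>A. x < a}) * ballot (card {a\<in>A. a < x}) (card {a\<in>A. a < x})"
proof -
  have "card (Av_tl (pat3 2 3 1) A x) =
      card (Av (pat3 2 3 1) {a\<in>A. a < x}) * card (Av (pat3 2 3 1) {a\<in>A. \<not> a < x})"
    using assms by (intro Av_tl_split) (auto simp: pat3_def not_less le_less)
  also have "{a\<in>A. \<not> a < x} = {a\<in>A. x < a}"
    using assms by (auto simp: not_less le_less)
  finally show ?thesis
    using assms card_Av_231[of "{a\<in>A. x < a}"] card_Av_231[of "{a\<in>A. a < x}"] by simp
qed

section \<open>Cardinalities on \<open>{1..n}\<close> and their comparison\<close>

lemma card_avoiders_eq:
  assumes "1 \<le> r" "r \<le> n"
  shows "card (avoiders n r [1, 2, 3]) = ballot (n - 1) (r - 1)"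
    and "card (avoiders n r [1, 3, 2]) = ballot (n - 1) (r - 1)"
    and "card (avoiders n r [3, 2, 1]) = ballot (n - 1) (n - r)"
    and "card (avoiders n r [3, 1, 2]) = ballot (n - 1) (n - r)"
    and "card (avoiders n r [2, 1, 3]) = ballot (n - r) (n - r) * ballot (r - 1) (r - 1)"
    and "card (avoiders n r [2, 3, 1]) = ballot (n - r) (n - r) * ballot (r - 1) (r - 1)"
proof -
  let ?A = "{1..n} - {r}"
  have "{a\<in>?A. a < r} = {1..<r}" "{a\<in>?A. r < a} = {r<..n}"
    using assms by auto
  then have c: "card {a\<in>?A. a < r} = r - 1" "card {a\<in>?A. r < a} = n - r" "card ?A = n - 1"
    using assms by auto
  have A: "finite ?A" "r \<notin> ?A" "0 \<notin> ?A" and r: "r \<in> {1..n}"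
    using assms by auto
  note card_avoiders[OF r]
  with card_Av_tl_123[OF A(1,2)] card_Av_tl_132[OF A(1,2)] card_Av_tl_321[OF A(1,2)]
    card_Av_tl_312[OF A(1,2)] card_Av_tl_213[OF A] card_Av_tl_231[OF A(1,2)]
  show "card (avoiders n r [1, 2, 3]) = ballot (n - 1) (r - 1)"
    and "card (avoiders n r [1, 3, 2]) = ballot (n - 1) (r - 1)"
    and "card (avoiders n r [3, 2, 1]) = ballot (n - 1) (n - r)"
    and "card (avoiders n r [3, 1, 2]) = ballot (n - 1) (n - r)"
    and "card (avoiders n r [2, 1, 3]) = ballot (n - r) (n - r) * ballot (r - 1) (r - 1)"
    and "card (avoiders n r [2, 3, 1]) = ballot (n - r) (n - r) * ballot (r - 1) (r - 1)"
    unfolding c by (simp_all only:)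
qed

text \<open>The simplifier turns \<open>1\<close> into \<open>Suc 0\<close>, also inside patterns,
  so the equations are kept in that form.\<close>

lemmas card_avoiders_simps = card_avoiders_eq[unfolded One_nat_def]

lemma ballot_pos: "k \<le> n \<Longrightarrow> 0 < ballot n k"
proof (induction n arbitrary: k)
  case (Suc n)
  show ?case
  proof (cases k)
    case (Suc l)
    then have "0 < ballot n l"
      using Suc.IH Suc.prems by simp
    then show ?thesis
      using Suc by simp
  qed (use Suc.IH[of 0] in simp)
qed simp

lemma ballot_0 [simp]: "ballot n 0 = 1"
  by (induction n) auto

text \<open>The recurrence of Catalan's triangle: the partial sums for \<open>Suc k\<close> and
  \<open>k\<close> differ by one term.\<close>

lemma ballot_Suc_Suc: "Suc k \<le> n \<Longrightarrow> ballot (Suc n) (Suc k) = ballot (Suc n) k + ballot n (Suc k)"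
  by simp

text \<open>At \<open>n = 2 * r\<close> the counts are neighbours in one row of the triangle, whose
  difference is a positive entry of the row before.\<close>

lemma not_wilf_123_321:
  assumes "2 \<le> r"
  shows "\<not> wilf_equivalent r [1, 2, 3] [3, 2, 1]"
proof -
  obtain k where r: "r = Suc (Suc k)"
    using assms by (metis add_2_eq_Suc le_iff_add)
  have "ballot (Suc (2 * k + 2)) (Suc k) < ballot (Suc (2 * k + 2)) (Suc (Suc k))"
    using ballot_Suc_Suc[of "Suc k" "2 * k + 2"] ballot_pos[of "Suc (Suc k)" "2 * k + 2"] by simp
  then have "card (avoiders (2 * r) r [1, 2, 3]) < card (avoiders (2 * r) r [3, 2, 1])"
    using r by (simp add: card_avoiders_simps del: ballot.simps)
  then show ?thesis
    unfolding wilf_equivalent_def by (metis less_irrefl le_add1 mult_2)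
qed

lemma not_wilf_123_213:
  assumes "2 \<le> r"
  shows "\<not> wilf_equivalent r [1, 2, 3] [2, 1, 3]"
proof -
  obtain k where r: "r = Suc (Suc k)"
    using assms by (metis add_2_eq_Suc le_iff_add)
  \<comment> \<open>The recursion for the right side contains the left side and the positive term
    \<open>ballot (Suc k) k\<close>.\<close>
  have "ballot (Suc k) (Suc k) < ballot (Suc (Suc k)) (Suc k)"
    using ballot_pos[of k "Suc k"] by (subst (2) ballot.simps(2)) (simp del: ballot.simps)
  then have "card (avoiders (Suc r) r [2, 1, 3]) < card (avoiders (Suc r) r [1, 2, 3])"
    using r by (simp add: card_avoiders_simps del: ballot.simps(2)) (simp add: ballot.simps(2)[of 0])
  then show ?thesis
    unfolding wilf_equivalent_def by (metis less_irrefl le_SucI order_refl)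
qed

text \<open>At \<open>n = r\<close> the counts are 1 and a Catalan number, which exceeds 1 only from
  \<open>r = 3\<close> on. For \<open>r = 2\<close>, length 3 gives 2 against 1.\<close>

lemma not_wilf_321_213:
  assumes "2 \<le> r"
  shows "\<not> wilf_equivalent r [3, 2, 1] [2, 1, 3]"
proof (cases "r = 2")
  case True
  then have "card (avoiders 3 r [3, 2, 1]) \<noteq> card (avoiders 3 r [2, 1, 3])"
    by (simp add: card_avoiders_simps) (simp add: numeral_eq_Suc)
  then show ?thesis
    using True unfolding wilf_equivalent_def by (metis le_SucI numeral_2_eq_2 numeral_3_eq_3 order_refl)
next
  case False
  then have "3 \<le> r"
    using assms by simp
  then obtain k where r: "r = Suc (Suc (Suc k))"
    by (metis Suc_le_D numeral_3_eq_3 Suc_le_mono)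
  \<comment> \<open>The sum has at least two positive terms, for \<open>j = k\<close> and
    \<open>j = Suc k\<close>.\<close>
  have "1 < ballot (Suc (Suc k)) (Suc (Suc k))"
    using ballot_pos[of "Suc k" "Suc k"] ballot_pos[of k "Suc k"]
    by (subst ballot.simps(2)) (simp del: ballot.simps)
  then have "card (avoiders r r [3, 2, 1]) < card (avoiders r r [2, 1, 3])"
    using r by (simp add: card_avoiders_simps del: ballot.simps(2))
  then show ?thesis
    unfolding wilf_equivalent_def by (metis less_irrefl order_refl)
qed

lemma wilf_123_132: "1 \<le> r \<Longrightarrow> wilf_equivalent r [1, 2, 3] [1, 3, 2]"
  by (simp add: wilf_equivalent_def card_avoiders_simps)

lemma wilf_321_312: "1 \<le> r \<Longrightarrow> wilf_equivalent r [3, 2, 1] [3, 1, 2]"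
  by (simp add: wilf_equivalent_def card_avoiders_simps)

lemma wilf_213_231: "1 \<le> r \<Longrightarrow> wilf_equivalent r [2, 1, 3] [2, 3, 1]"
  by (simp add: wilf_equivalent_def card_avoiders_simps)

text \<open>Nothing lies below the head 1, so the lower factor is \<open>ballot 0 0 = 1\<close> and
  both counts are Catalan numbers.\<close>

lemma wilf_1_321_213: "wilf_equivalent 1 [3, 2, 1] [2, 1, 3]"
  by (simp add: wilf_equivalent_def card_avoiders_simps)

lemma not_wilf_1_123_321: "\<not> wilf_equivalent 1 [1, 2, 3] [3, 2, 1]"
proof -
  have "ballot 2 2 = 2"
    by (simp add: numeral_2_eq_2)
  then have "card (avoiders 3 1 [1, 2, 3]) \<noteq> card (avoiders 3 1 [3, 2, 1])"
    using card_avoiders_eq(1,3)[of 1 3] by simp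
  then show ?thesis
    unfolding wilf_equivalent_def by (metis one_le_numeral)
qed

section \<open>Assembling the equivalence classes\<close>

lemma perms_3: "perms 3 = {[1,2,3], [1,3,2], [2,1,3], [2,3,1], [3,1,2], [3,2,1]}"
proof -
  have "{1..3} = {1, 2, 3 :: nat}"
    by auto
  moreover have "{1, 2, 3} - {1} = {2, 3 :: nat}" "{1, 2, 3} - {2} = {1, 3 :: nat}"
      "{1, 2, 3} - {3} = {1, 2 :: nat}"
    by auto
  ultimately have "perms 3 = (#) 1 ` {[2, 3], [3, 2]} \<union> (#) 2 ` {[1, 3], [3, 1]} \<union> (#) 3 ` {[1, 2], [2, 1]}"
    unfolding perms_def
    by (simp only: permutations_of_set_nonempty[of "{1, 2, 3}"] permutations_of_set_doubleton Un_assoc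
        insert_not_empty UN_insert UN_empty Un_empty_right simp_thms
        num.distinct numeral_eq_iff one_eq_numeral_iff)
  then show ?thesis
    by auto
qed

text \<open>Turns Wilf equivalence into equality of functions, so that equivalences act as rewrite
  rules; the value 0 masks the lengths below \<open>r\<close>.\<close>

definition avoider_counts :: "nat \<Rightarrow> nat list \<Rightarrow> nat \<Rightarrow> nat" where
  "avoider_counts r \<sigma> n = (if r \<le> n then card (avoiders n r \<sigma>) else 0)"

lemma wilf_equivalent_iff_counts:
  "wilf_equivalent r \<sigma> \<sigma>' \<longleftrightarrow> avoider_counts r \<sigma> = avoider_counts r \<sigma>'"
  by (auto simp: wilf_equivalent_def avoider_counts_def fun_eq_iff)

text \<open>Each block is the class of any of its members; nonemptiness provides a representative,
  and covering ensures that no class is missed.\<close>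

lemma wilf_classes_eqI:
  assumes "\<Union>P = perms k" "{} \<notin> P"
    and "\<forall>C\<in>P. \<forall>\<sigma>\<in>C. \<forall>\<sigma>'\<in>perms k. wilf_equivalent r \<sigma> \<sigma>' \<longleftrightarrow> \<sigma>' \<in> C"
  shows "wilf_classes r k = P"
proof -
  let ?E = "{(\<sigma>, \<sigma>'). \<sigma> \<in> perms k \<and> \<sigma>' \<in> perms k \<and> wilf_equivalent r \<sigma> \<sigma>'}"
  have cls: "?E `` {\<sigma>} = C" if "C \<in> P" "\<sigma> \<in> C" for C \<sigma>
    using that assms by blast
  show ?thesis
  proof (intro equalityI subsetI)
    fix D assume "D \<in> wilf_classes r k"
    then obtain \<sigma> where "\<sigma> \<in> perms k" "D = ?E `` {\<sigma>}"
      unfolding wilf_classes_def by (elim quotientE)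
    then show "D \<in> P"
      using cls assms(1) by blast
  next
    fix C assume C: "C \<in> P"
    then obtain \<sigma> where \<sigma>: "\<sigma> \<in> C"
      using assms(2) by (metis ex_in_conv)
    then have "\<sigma> \<in> perms k"
      using C assms(1) by blast
    then show "C \<in> wilf_classes r k"
      unfolding wilf_classes_def cls[OF C \<sigma>, symmetric] by (rule quotientI)
  qed
qed

theorem theorem7p1:
  shows "(card (wilf_classes 1 3) = 2 \<and>
          wilf_classes 1 3 =
            {{[1,2,3], [1,3,2]},
             {[3,2,1], [3,1,2], [2,1,3], [2,3,1]}}) \<and>
         (\<forall>r\<ge>2.
            card (wilf_classes r 3) = 3 \<and>
            wilf_classes r 3 =
              {{[2,1,3], [2,3,1]},
               {[1,2,3], [1,3,2]},
               {[3,2,1], [3,1,2]}})"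
proof (intro conjI allI impI)
  have card2: "card {a, b} = 2" if "a \<noteq> b" for a b :: "nat list set"
    using that by simp
  show 1: "wilf_classes 1 3 = {{[1,2,3], [1,3,2]}, {[3,2,1], [3,1,2], [2,1,3], [2,3,1]}}"
    using wilf_123_132[of 1] wilf_321_312[of 1] wilf_213_231[of 1] wilf_1_321_213 not_wilf_1_123_321
    by (intro wilf_classes_eqI) (simp_all add: perms_3 wilf_equivalent_iff_counts insert_commute)
  have "[1,2,3] \<notin> {[3,2,1], [3,1,2], [2,1,3], [2,3,1::nat]}"
    by simp
  then show "card (wilf_classes 1 3) = 2"
    unfolding 1 by (intro card2) (metis insertI1)
next
  have card3: "card {a, b, c} = 3" if "a \<noteq> b" "a \<noteq> c" "b \<noteq> c" for a b c :: "nat list set"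
    using that by simp
  fix r :: nat assume r: "2 \<le> r"
  \<comment> \<open>One non-equivalence per pair of blocks suffices: within a block the count
    functions are equal, so it carries over to all members.\<close>
  show 2: "wilf_classes r 3 = {{[2,1,3], [2,3,1]}, {[1,2,3], [1,3,2]}, {[3,2,1], [3,1,2]}}"
    using wilf_123_132[of r] wilf_321_312[of r] wilf_213_231[of r] r
      not_wilf_123_321[OF r] not_wilf_123_213[OF r] not_wilf_321_213[OF r]
    by (intro wilf_classes_eqI) (simp_all add: perms_3 wilf_equivalent_iff_counts insert_commute)
  show "card (wilf_classes r 3) = 3"
    unfolding 2 by (intro card3) (simp_all add: doubleton_eq_iff)
qed

end
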